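(* For every integer $m>4$ there are algebraic numbers $\alpha_1,\alpha_2\in\overline{\mathbb{Q}}$ (depending on $m$) such that $$\pi\, B\!\left(\tfrac1m,\tfrac12-\tfrac2m\right)\;{}_3F_2\!\left(\tfrac12,\tfrac12,\tfrac1m;\,1,\tfrac12-\tfrac1m;\,1\right)=\alpha_1\, B\!\left(\tfrac14,\tfrac1m\right)^2+\alpha_2\, B\!\left(\tfrac34,\tfrac1m\right)^2 .$$
   Context: $B(a,b)=\Gamma(a)\Gamma(b)/\Gamma(a+b)$ is the beta function. The hypergeometric series is ${}_3F_2(a_1,a_2,a_3;1,b;1)=\sum_{k\ge 0}\frac{(a_1)_k(a_2)_k(a_3)_k}{k!\,(1)_k\,(b)_k}$, with $(a)_k=a(a+1)\cdots(a+k-1)$. *)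

theory Defs
  imports "HOL-Analysis.Analysis" "HOL-Real_Asymp.Real_Asymp"
begin

(* 3F2(a1, a2, a3; b1, b2; z).  Defined by suminf, so it is meaningful only where the
   series converges; see summable_hypergeom_3F2_half for the instance of interest. *)
definition hypergeom_3F2 ::
    "'a::{real_normed_field,banach} \<Rightarrow> 'a \<Rightarrow> 'a \<Rightarrow> 'a \<Rightarrow> 'a \<Rightarrow> 'a \<Rightarrow> 'a" where
  "hypergeom_3F2 a1 a2 a3 b1 b2 z =
     (\<Sum>k. pochhammer a1 k * pochhammer a2 k * pochhammer a3 k /
          (fact k * pochhammer b1 k * pochhammer b2 k) * z ^ k)"

lemma summable_hypergeom_3F2_half:
  fixes m :: nat
  assumes m: "m > 4"
  shows "summable (\<lambda>k. pochhammer (1/2) k * pochhammer (1/2) k * pochhammer (1 / real m) k /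
          (fact k * pochhammer 1 k * pochhammer (1/2 - 1 / real m) k) * 1 ^ k)"
    (is "summable ?f")
proof (rule raabes_test_convergence)
  define c where "c = 1 / real m"
  define b where "b = 1/2 - c"
  have c: "c > 0" "c < 1/4" using m by (auto simp: c_def field_simps)
  have b: "b > 0" using c by (simp add: b_def)
  have pos: "?f n > 0" for n
    using c b unfolding c_def b_def
    by (intro mult_pos_pos divide_pos_pos pochhammer_pos) auto
  then show "eventually (\<lambda>n. ?f n > 0) sequentially" by simp
  have ratio: "?f n / ?f (Suc n) =
      (real n + 1)\<^sup>2 * (real n + b) / ((real n + 1/2)\<^sup>2 * (real n + c))" for n
  proof -
    have "?f (Suc n) = ?f n * (((real n + 1/2)\<^sup>2 * (real n + c)) / ((real n + 1)\<^sup>2 * (real n + b)))"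
      unfolding b_def c_def by (simp add: pochhammer_Suc power2_eq_square add_ac mult_ac)
    moreover have "x / (x * (p / r)) = r / p" if "x > 0" for x p r :: real
      using that by simp
    ultimately show ?thesis using pos[of n] by metis
  qed
  have "((\<lambda>n. real n * ((real n + 1)\<^sup>2 * (real n + b) / ((real n + 1/2)\<^sup>2 * (real n + c)) - 1))
          \<longlongrightarrow> 1 + (b - c)) sequentially"
    by (real_asymp simp: field_simps)
  then have "((\<lambda>n. real n * (?f n / ?f (Suc n) - 1)) \<longlongrightarrow> 1 + (b - c)) sequentially"
    by (simp only: ratio)
  then have "liminf (\<lambda>n. ereal (real n * (?f n / ?f (Suc n) - 1))) = ereal (1 + (b - c))"
    by (intro lim_imp_Liminf) (auto intro: tendsto_ereal)
  also have "\<dots> > 1" using c by (simp add: b_def one_ereal_def)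
  finally show "liminf (\<lambda>n. ereal (real n * (?f n / ?f (Suc n) - 1))) > 1" .
qed

end

theory Submission
  imports Defs
begin

text \<open>
  The series is contiguous to a well-poised one. With
  \<open>t\<^sub>k = (1/2)\<^sub>k\<^sup>2 (c)\<^sub>k / (k!\<^sup>2 (3/2 - c)\<^sub>k)\<close> and \<open>c = 1/m\<close>, its general term is
  \<open>t\<^sub>k (k + 1/2 - c) / (1/2 - c)\<close>, a combination of \<open>t\<^sub>k\<close> and \<open>(1 + 4 k) t\<^sub>k\<close>. Both of these
  are summed by Dougall's well-poised 5F4 theorem with \<open>a = b = 1/2\<close>, taking \<open>d = a/2\<close> and
  \<open>d = (1 + a)/2\<close> respectively. The resulting Gamma quotients turn into squares of Beta values by
  the duplication and reflection formulas, the remaining factors being sines of rational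
  multiples of \<open>\<pi>\<close> and rational powers of \<open>2\<close>.

  Dougall's theorem follows by relating the sums at \<open>a\<close> and \<open>a + 1\<close> through a
  Wilf--Zeilberger certificate and letting \<open>a + n\<close> tend to infinity.
\<close>

section \<open>Closure properties of algebraic numbers\<close>

text \<open>Viewing the field as a vector space over the rationals makes dimension bounds available:
  a number is algebraic exactly when its powers lie in a finitely generated rational span.\<close>

interpretation rat_space: vector_space "\<lambda>(q::rat) (x::'a::field_char_0). of_rat q * x"
  by unfold_locales (simp_all add: algebra_simps of_rat_add of_rat_mult)

text \<open>A span of \<open>card T\<close> vectors holds no \<open>card T + 1\<close> independent
  ones, so the powers of \<open>x\<close> up to exponent \<open>card T\<close> satisfy a rational
  linear relation, which is a polynomial vanishing at \<open>x\<close>.\<close>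

lemma algebraic_if_powers_in_span:
  fixes x :: "'a::field_char_0"
  assumes "finite T" and powers: "\<And>n. x ^ n \<in> rat_space.span T"
  shows "algebraic x"
proof (cases "inj_on (\<lambda>i. x ^ i) {..card T}")
  case True
  define S where "S = (\<lambda>i. x ^ i) ` {..card T}"
  have "card S = Suc (card T)"
    using True by (simp add: S_def card_image)
  moreover have "S \<subseteq> rat_space.span T"
    using powers by (auto simp: S_def)
  ultimately have "rat_space.dependent S"
    using rat_space.independent_span_bound[OF \<open>finite T\<close>, of S] by auto
  then obtain u v where u: "v \<in> S" "u v \<noteq> 0" "(\<Sum>v\<in>S. of_rat (u v) * v) = 0"
    by (subst (asm) rat_space.dependent_finite) (auto simp: S_def)
  define p where "p = (\<Sum>i\<le>card T. monom (of_rat (u (x ^ i)) :: 'a) i)"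
  have coeff_p: "coeff p j = (if j \<le> card T then of_rat (u (x ^ j)) else 0)" for j
    by (auto simp: p_def coeff_sum)
  show ?thesis
  proof (rule algebraicI')
    show "coeff p i \<in> \<rat>" for i
      by (simp add: coeff_p)
    show "p \<noteq> 0"
    proof
      assume "p = 0"
      obtain i where "i \<le> card T" "v = x ^ i"
        using u(1) by (auto simp: S_def)
      with coeff_p[of i] u(2) \<open>p = 0\<close> show False by simp
    qed
    have "poly p x = (\<Sum>i\<le>card T. of_rat (u (x ^ i)) * x ^ i)"
      by (simp add: p_def poly_sum poly_monom)
    also have "\<dots> = (\<Sum>v\<in>S. of_rat (u v) * v)"
      unfolding S_def using True by (simp add: sum.reindex)
    finally show "poly p x = 0" using u(3) by simp
  qed
next
  \<comment> \<open>Two powers coincide, so the set of powers may be too small for the dimension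
    bound; the difference of the two monomials then vanishes at \<open>x\<close>.\<close>
  case False
  then obtain i j where "i \<noteq> j" "x ^ i = x ^ j"
    by (auto simp: inj_on_def)
  show ?thesis
  proof (rule algebraicI')
    show "coeff (monom 1 i - monom 1 j :: 'a poly) k \<in> \<rat>" for k
      by simp
    show "monom 1 i - monom 1 j \<noteq> (0 :: 'a poly)"
      using \<open>i \<noteq> j\<close> by (simp add: monom_eq_iff')
    show "poly (monom 1 i - monom 1 j) x = 0"
      using \<open>x ^ i = x ^ j\<close> by (simp add: poly_monom)
  qed
qed

text \<open>A polynomial relation of degree \<open>n\<close> rewrites \<open>x ^ n\<close> through
  lower powers; strong induction then reduces every exponent below \<open>n\<close>.\<close>

lemma algebraic_powers_in_span:
  fixes x :: "'a::field_char_0"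
  assumes "algebraic x"
  obtains T where "finite T" "\<And>n. x ^ n \<in> rat_space.span T"
proof -
  obtain p where p: "p \<noteq> 0" "poly (map_poly of_int p) x = 0"
    using assms by (rule algebraicE')
  define n where "n = degree p"
  define T where "T = (\<lambda>i. x ^ i) ` {..<n}"
  have "(\<Sum>i\<le>n. of_int (coeff p i) * x ^ i) = 0"
    using p(2) by (simp add: poly_altdef n_def degree_map_poly coeff_map_poly)
  then have "of_int (lead_coeff p) * x ^ n = - (\<Sum>i<n. of_int (coeff p i) * x ^ i)"
    by (simp add: n_def flip: lessThan_Suc_atMost) (simp add: add_eq_0_iff2)
  then have top: "x ^ n = (\<Sum>i<n. of_rat (- of_int (coeff p i) / of_int (lead_coeff p)) * x ^ i)"
    using p(1) by (simp add: of_rat_divide of_rat_minus sum_divide_distrib[symmetric] field_simps sum_negf)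
  have "x ^ k \<in> rat_space.span T" for k
  proof (induction k rule: less_induct)
    case (less k)
    show ?case
    proof (cases "k < n")
      case True
      then show ?thesis by (auto simp: T_def intro: rat_space.span_base)
    next
      case False
      have "x ^ k = x ^ n * x ^ (k - n)"
        using False by (simp flip: power_add)
      also have "\<dots> = (\<Sum>i<n. of_rat (- of_int (coeff p i) / of_int (lead_coeff p)) * x ^ (i + (k - n)))"
        by (subst top) (simp add: sum_distrib_left sum_distrib_right power_add mult_ac)
      also have "\<dots> \<in> rat_space.span T"
        using False by (intro rat_space.span_sum rat_space.span_scale less.IH) auto
      finally show ?thesis .
    qed
  qed
  then show ?thesis using that[of T] by (auto simp: T_def)
qed

lemma mult_in_span:
  fixes u v :: "'a::field_char_0"
  assumes "u \<in> rat_space.span A" "v \<in> rat_space.span B"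
  shows "u * v \<in> rat_space.span ((\<lambda>(a, b). a * b) ` (A \<times> B))"
  using assms(1)
proof (induction u rule: rat_space.span_induct_alt)
  case base
  then show ?case by (simp add: rat_space.span_zero)
next
  case (step q a u)
  have "a * v \<in> rat_space.span ((\<lambda>(a, b). a * b) ` (A \<times> B))"
    using assms(2)
  proof (induction v rule: rat_space.span_induct_alt)
    case base
    then show ?case by (simp add: rat_space.span_zero)
  next
    case (step r b v)
    have "a * b \<in> rat_space.span ((\<lambda>(a, b). a * b) ` (A \<times> B))"
      using \<open>a \<in> A\<close> \<open>b \<in> B\<close> by (intro rat_space.span_base) auto
    from rat_space.span_add[OF rat_space.span_scale[OF this, of r] step(2)]
    show ?case by (simp add: algebra_simps)
  qed
  from rat_space.span_add[OF rat_space.span_scale[OF this, of q] step(2)]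
  show ?case by (simp add: algebra_simps)
qed

text \<open>By bilinearity the pairwise products of two finite spanning sets suffice. The powers of
  \<open>x * y\<close> and of \<open>x + y\<close> both lie in this one span, which yields closure
  under products and sums.\<close>

lemma algebraic_monomials_in_span:
  fixes x y :: "'a::field_char_0"
  assumes "algebraic x" "algebraic y"
  obtains T where "finite T" "\<And>i j. x ^ i * y ^ j \<in> rat_space.span T"
proof -
  obtain A where A: "finite A" "\<And>n. x ^ n \<in> rat_space.span A"
    using algebraic_powers_in_span[OF assms(1)] by blast
  obtain B where B: "finite B" "\<And>n. y ^ n \<in> rat_space.span B"
    using algebraic_powers_in_span[OF assms(2)] by blast
  show ?thesis
    using that[of "(\<lambda>(a, b). a * b) ` (A \<times> B)"] mult_in_span A B by blast
qed

lemma algebraic_mult: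
  fixes x y :: "'a::field_char_0"
  assumes "algebraic x" "algebraic y"
  shows "algebraic (x * y)"
proof -
  obtain T where "finite T" "\<And>i j. x ^ i * y ^ j \<in> rat_space.span T"
    using algebraic_monomials_in_span[OF assms] by blast
  then show ?thesis
    by (intro algebraic_if_powers_in_span[of T]) (simp_all add: power_mult_distrib)
qed

lemma algebraic_add:
  fixes x y :: "'a::field_char_0"
  assumes "algebraic x" "algebraic y"
  shows "algebraic (x + y)"
proof -
  obtain T where T: "finite T" "\<And>i j. x ^ i * y ^ j \<in> rat_space.span T"
    using algebraic_monomials_in_span[OF assms] by blast
  have "(x + y) ^ n \<in> rat_space.span T" for n
  proof -
    have "(x + y) ^ n = (\<Sum>k\<le>n. of_rat (of_nat (n choose k)) * (x ^ k * y ^ (n - k)))"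
      by (simp add: binomial_ring mult.assoc)
    also have "\<dots> \<in> rat_space.span T"
      by (intro rat_space.span_sum rat_space.span_scale T)
    finally show ?thesis .
  qed
  with T(1) show ?thesis by (rule algebraic_if_powers_in_span)
qed

lemma algebraic_divide:
  fixes x y :: "'a::field_char_0"
  assumes "algebraic x" "algebraic y"
  shows "algebraic (x / y)"
  unfolding divide_inverse using assms by (intro algebraic_mult algebraic_inverse)

lemma algebraic_power:
  fixes x :: "'a::field_char_0"
  assumes "algebraic x"
  shows "algebraic (x ^ n)"
  using assms by (induction n) (auto intro: algebraic_mult)

lemma algebraic_if_power:
  fixes x :: "'a::field_char_0"
  assumes "algebraic (x ^ n)" "n > 0"
  shows "algebraic x"
proof (rule algebraic_root[of "x ^ n"])
  show "poly (monom 1 n) x = x ^ n" by (simp add: poly_monom)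
  show "degree (monom (1::'a) n) > 0" using assms(2) by (simp add: degree_monom_eq)
qed (use assms in \<open>auto simp: degree_monom_eq\<close>)

section \<open>Algebraicity of sines at rational multiples of pi and of rational powers\<close>

lemma algebraic_sin_rational_pi:
  fixes r :: real
  assumes "r \<in> \<rat>"
  shows "algebraic (complex_of_real (sin (pi * r)))"
proof -
  obtain p :: int and q :: nat where pq: "q > 0" "r = of_int p / of_nat q"
    using assms by (auto simp: Rats_eq_int_div_nat)
  \<comment> \<open>Both exponentials in Euler's formula for the sine are roots of unity; the sign
    \<open>s\<close> treats them together.\<close>
  have root: "cis (s * (pi * r)) ^ (2 * q) = 1" if "s = 1 \<or> s = -1" for s :: real
  proof -
    have "real (2 * q) * (s * (pi * r)) = 2 * pi * of_int (if s = 1 then p else - p)"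
      using that pq by (auto simp: field_simps)
    then have "cis (s * (pi * r)) ^ (2 * q) = cis (2 * pi * of_int (if s = 1 then p else - p))"
      by (simp only: Complex.DeMoivre)
    then show ?thesis by (simp only: cis_multiple_2pi Ints_of_int)
  qed
  have "algebraic (cis (s * (pi * r)))" if "s = 1 \<or> s = -1" for s :: real
    by (rule algebraic_if_power[of _ "2 * q"], unfold root[OF that]) (use pq(1) in auto)
  from this[of 1] this[of "-1"] have "algebraic (cis (pi * r))" "algebraic (cis (- (pi * r)))"
    by simp_all
  then have "algebraic ((cis (pi * r) + - cis (- (pi * r))) / (2 * \<i>))"
    by (intro algebraic_divide algebraic_add algebraic_mult algebraic_minus) auto
  also have "(cis (pi * r) + - cis (- (pi * r))) / (2 * \<i>) = complex_of_real (sin (pi * r))"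
    by (simp add: complex_eq_iff Re_divide Im_divide power2_eq_square)
  finally show ?thesis .
qed

text \<open>With \<open>r = p / q\<close>, the \<open>q\<close>-th power of \<open>x powr r\<close>
  is the rational number \<open>x powi p\<close>.\<close>

lemma algebraic_powr_rational:
  fixes r x :: real
  assumes "r \<in> \<rat>" "x \<in> \<rat>" "x > 0"
  shows "algebraic (complex_of_real (x powr r))"
proof -
  obtain p :: int and q :: nat where pq: "q > 0" "r = of_int p / of_nat q"
    using assms(1) by (auto simp: Rats_eq_int_div_nat)
  have "(x powr r) ^ q = x powr of_int p"
    using pq assms(3) by (simp add: powr_power)
  then have "complex_of_real (x powr r) ^ q = complex_of_real (x powi p)"
    using assms(3) by (simp add: powr_real_of_int' flip: of_real_power)
  moreover have "complex_of_real (x powi p) \<in> \<rat>"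
    using assms(2) by (auto simp: power_int_def elim!: Rats_cases)
  ultimately show ?thesis
    using pq(1) by (metis algebraic_if_power rat_imp_algebraic)
qed

section \<open>Dougall's well-poised 5F4 summation theorem\<close>

text \<open>The summand of the very-well-poised 5F4 at argument 1 with upper parameters
  \<open>a, 1 + a/2, b, c, d\<close>; the linear factor is the quotient of the Pochhammer symbols of
  \<open>1 + a/2\<close> and \<open>a/2\<close>.\<close>

definition dougall_term :: "real \<Rightarrow> real \<Rightarrow> real \<Rightarrow> real \<Rightarrow> nat \<Rightarrow> real" where
  "dougall_term a b c d k = (1 + 2 * real k / a) *
     (pochhammer a k * pochhammer b k * pochhammer c k * pochhammer d k) /
     (fact k * pochhammer (1 + a - b) k * pochhammer (1 + a - c) k * pochhammer (1 + a - d) k)"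

lemma dougall_term_0 [simp]: "dougall_term a b c d 0 = 1"
  by (simp add: dougall_term_def)

lemma dougall_term_Suc:
  assumes "a > 0"
  shows "dougall_term a b c d (Suc k) = dougall_term a b c d k *
    ((a + 2 * real k + 2) * ((a + k) * (b + k) * (c + k) * (d + k)) /
     ((a + 2 * real k) * (k + 1) * ((1 + a - b + k) * (1 + a - c + k) * (1 + a - d + k))))"
proof -
  have "1 + 2 * real i / a = (a + 2 * i) / a" for i
    using assms by (simp add: add_divide_distrib)
  moreover have "a + 2 * real k > 0"
    using assms by (simp add: add_pos_nonneg)
  ultimately have "1 + 2 * real (Suc k) / a = (1 + 2 * real k / a) * ((a + 2 * real k + 2) / (a + 2 * real k))"
    using assms by (simp only: times_divide_times_eq) simp
  then show ?thesis
    unfolding dougall_term_def by (simp add: pochhammer_Suc mult_ac add_ac)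
qed

lemma pochhammer_shift:
  fixes x :: real
  assumes "x > 0"
  shows "pochhammer (x + 1) k = pochhammer x k * ((x + k) / x)"
  using assms pochhammer_rec[of x k] pochhammer_rec'[of x k] by (simp add: field_simps)

lemma dougall_term_shift:
  assumes "a > 0" "b < 1 + a" "c < 1 + a" "d < 1 + a"
  shows "dougall_term (a + 1) b c d k = dougall_term a b c d k *
    ((a + 1 + 2 * real k) * (a + k) * ((1 + a - b) * (1 + a - c) * (1 + a - d)) /
     ((a + 1) * (a + 2 * real k) * ((1 + a - b + k) * (1 + a - c + k) * (1 + a - d + k))))"
proof -
  have 1: "1 + 2 * real k / (a + 1) = (1 + 2 * real k / a) * (a * (a + 1 + 2 * real k) / ((a + 1) * (a + 2 * real k)))"
  proof -
    have "1 + 2 * real k / y = (y + 2 * k) / y" "y + 2 * real k > 0" if "y > 0" for y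
      using that by (simp_all add: add_divide_distrib add_pos_nonneg)
    from this[of a] this[of "a + 1"] assms(1) show ?thesis by simp
  qed
  have 2: "pochhammer (1 + (a + 1) - x) k = pochhammer (1 + a - x) k * ((1 + a - x + k) / (1 + a - x))"
    if "x < 1 + a" for x
    using pochhammer_shift[of "1 + a - x" k] that by (simp add: algebra_simps)
  show ?thesis
    unfolding dougall_term_def 1 2[OF assms(2)] 2[OF assms(3)] 2[OF assms(4)] pochhammer_shift[OF assms(1)]
    using assms(1) by (simp add: mult_ac)
qed

lemma dougall_term_nonneg:
  assumes "a > 0" "b > 0" "c > 0" "d > 0" "b < 1 + a" "c < 1 + a" "d < 1 + a"
  shows "dougall_term a b c d k \<ge> 0"
  unfolding dougall_term_def using assms
  by (intro divide_nonneg_nonneg mult_nonneg_nonneg add_nonneg_nonneg pochhammer_nonneg) auto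

text \<open>The assumption \<open>a \<ge> 1/2\<close> enters as \<open>1/a \<le> 3/(1 + a)\<close>.\<close>
lemma dougall_term_shift_le:
  assumes "a \<ge> 1/2" "b > 0" "c > 0" "d > 0" "b < 1 + a" "c < 1 + a" "d < 1 + a"
  shows "dougall_term (a + 1) b c d k \<le> dougall_term a b c d k"
proof -
  define x where "x = real k"
  have "x \<ge> 0" "a > 0" using assms by (auto simp: x_def)
  \<comment> \<open>\<open>v\<close> bounds from below each of the three quotients
    \<open>(1 + a - y + x) / (1 + a - y)\<close> with \<open>y\<close> one of
    \<open>b, c, d\<close>. Their product is thus at least \<open>v ^ 3\<close>, which Bernoulli's
    inequality compares with \<open>(a + x) / a\<close>.\<close>
  define v where "v = 1 + x / (1 + a)"
  have v: "1 \<le> v" "v \<le> (1 + a - y + x) / (1 + a - y)" if "y > 0" "y < 1 + a" for y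
  proof -
    have "x / (1 + a) \<le> x / (1 + a - y)"
      using that \<open>x \<ge> 0\<close> by (intro divide_left_mono) auto
    with that show "v \<le> (1 + a - y + x) / (1 + a - y)"
      by (simp add: v_def add_divide_distrib)
    show "1 \<le> v" using \<open>x \<ge> 0\<close> \<open>a > 0\<close> by (simp add: v_def)
  qed
  define P where "P = (1 + a - b) * (1 + a - c) * (1 + a - d)"
  define Q where "Q = (1 + a - b + x) * (1 + a - c + x) * (1 + a - d + x)"
  have pos: "P > 0" "Q > 0"
    using assms \<open>x \<ge> 0\<close> by (auto simp: P_def Q_def intro!: mult_pos_pos add_pos_nonneg)
  have "(a + x) / a = 1 + x / a"
    using \<open>a > 0\<close> by (simp add: field_simps)
  also have "x / a \<le> 3 * (x / (1 + a))"
    using mult_left_mono[OF assms(1), of "x * 2"] \<open>a > 0\<close> \<open>x \<ge> 0\<close> by (simp add: field_simps)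
  also have "1 + 3 * (x / (1 + a)) \<le> v ^ 3"
    using Bernoulli_inequality[of "x / (1 + a)" 3] \<open>a > 0\<close> \<open>x \<ge> 0\<close>
    by (simp add: v_def) (smt (verit) divide_nonneg_pos)
  also have "\<dots> = v * v * v" by (simp add: power3_eq_cube)
  also have "\<dots> \<le> (1 + a - b + x) / (1 + a - b) * ((1 + a - c + x) / (1 + a - c)) * ((1 + a - d + x) / (1 + a - d))"
    using assms v v(1)[of b] by (intro mult_mono mult_nonneg_nonneg divide_nonneg_nonneg) (auto simp: \<open>x \<ge> 0\<close>)
  also have "\<dots> = Q / P" by (simp add: P_def Q_def)
  finally have 1: "(a + x) * P \<le> a * Q"
    using pos \<open>a > 0\<close> by (simp add: field_simps)
  \<comment> \<open>This handles the remaining part of the shift quotient, coming from the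
    very-well-poised linear factor.\<close>
  have "a * (a + 1 + 2 * x) \<le> (a + 1) * (a + 2 * x)"
    using \<open>x \<ge> 0\<close> by (simp add: algebra_simps)
  from mult_mono[OF this 1] have "a * ((a + 1 + 2 * x) * (a + x) * P) \<le> a * ((a + 1) * (a + 2 * x) * Q)"
    using pos \<open>a > 0\<close> \<open>x \<ge> 0\<close> by (simp add: mult_ac)
  then have "(a + 1 + 2 * x) * (a + x) * P / ((a + 1) * (a + 2 * x) * Q) \<le> 1"
    using pos \<open>a > 0\<close> \<open>x \<ge> 0\<close> by (simp add: divide_le_eq_1 add_pos_nonneg)
  moreover have "dougall_term a b c d k \<ge> 0"
    using assms \<open>a > 0\<close> by (intro dougall_term_nonneg)
  ultimately show ?thesis
    unfolding dougall_term_shift[OF \<open>a > 0\<close> assms(5-7)] P_def Q_def x_def by (intro mult_left_le)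
qed

text \<open>\<open>G\<close> is the term times its rational Wilf--Zeilberger certificate for the shift \<open>a \<mapsto> a + 1\<close>.\<close>
lemma dougall_wz:
  fixes a b c d :: real
  assumes "a > 0" "b < 1 + a" "c < 1 + a" "d < 1 + a"
  defines "G \<equiv> \<lambda>k::nat. - (k * (k + 1 + 2 * a - b - c - d) / (a + 2 * real k)) * dougall_term a b c d k"
  shows "(1 + a - b - c - d) * dougall_term a b c d k
    - (1 + a) * ((1 + a - b - c) * (1 + a - b - d) * (1 + a - c - d)) /
      ((1 + a - b) * (1 + a - c) * (1 + a - d)) * dougall_term (a + 1) b c d k
    = G (Suc k) - G k"
proof -
  define x where "x = real k"
  define P where "P = (1 + a - b) * (1 + a - c) * (1 + a - d)"
  define Q where "Q = (1 + a - b + x) * (1 + a - c + x) * (1 + a - d + x)"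
  define M where "M = (1 + a - b - c) * (1 + a - b - d) * (1 + a - c - d)"
  define t where "t = dougall_term a b c d k"
  define R where "R = (a + x) * (b + x) * (c + x) * (d + x)"
  have pos: "P > 0" "Q > 0" "a + 2 * x > 0" "x \<ge> 0" "a + 2 * x + 2 > 0"
    using assms by (auto simp: P_def Q_def x_def intro!: mult_pos_pos add_pos_nonneg)
  have t1: "dougall_term (a + 1) b c d k = t * ((a + 1 + 2 * x) * (a + x) * P / ((a + 1) * (a + 2 * x) * Q))"
    using dougall_term_shift[OF assms(1-4), of k] by (simp add: P_def Q_def x_def t_def)
  have t2: "dougall_term a b c d (Suc k) = t * ((a + 2 * x + 2) * R / ((a + 2 * x) * (x + 1) * Q))"
    using dougall_term_Suc[OF assms(1), of b c d k] by (simp add: R_def Q_def x_def t_def)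
  \<comment> \<open>The factors \<open>a + 2 * x + 2\<close> and \<open>x + 1\<close> of the term
    ratio cancel against the certificate, leaving the denominator \<open>(a + 2 * x) * Q\<close>
    shared by all parts of the identity.\<close>
  have G1: "G (Suc k) = - t * ((x + 2 + 2 * a - b - c - d) * R) / ((a + 2 * x) * Q)"
  proof -
    have "G (Suc k) = - ((x + 1) * (x + 2 + 2 * a - b - c - d) / (a + 2 * x + 2)) *
        (t * ((a + 2 * x + 2) * R / ((a + 2 * x) * (x + 1) * Q)))"
      by (simp add: G_def t2 x_def add_ac)
    also have "\<dots> = - t * ((x + 2 + 2 * a - b - c - d) * R) / ((a + 2 * x) * Q)"
      using pos by (simp add: divide_simps)
    finally show ?thesis .
  qed
  have G0: "G k = - t * (x * (x + 1 + 2 * a - b - c - d) * Q) / ((a + 2 * x) * Q)"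
    using pos by (simp add: G_def x_def t_def)
  have "(1 + a - b - c - d) * t - (1 + a) * M / P * dougall_term (a + 1) b c d k
      = t * ((1 + a - b - c - d) * (a + 2 * x) * Q - M * (a + 1 + 2 * x) * (a + x)) / ((a + 2 * x) * Q)"
    unfolding t1 using pos assms(1) by (simp add: divide_simps) (simp add: algebra_simps)
  \<comment> \<open>With the common denominator and \<open>t\<close> split off, the certificate
    amounts to this polynomial identity.\<close>
  also have "(1 + a - b - c - d) * (a + 2 * x) * Q - M * (a + 1 + 2 * x) * (a + x)
      = - ((x + 2 + 2 * a - b - c - d) * R) + x * (x + 1 + 2 * a - b - c - d) * Q"
    unfolding Q_def M_def R_def by algebra
  also have "t * \<dots> / ((a + 2 * x) * Q) = G (Suc k) - G k"
    unfolding G1 G0 by (simp add: algebra_simps diff_divide_distrib add_divide_distrib)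
  finally show ?thesis
    by (simp add: t_def M_def P_def)
qed

section \<open>Asymptotics of the terms and convergence\<close>

text \<open>A quotient of two Euler limits for Gamma. \<open>Gamma_series\<close> involves
  Pochhammer symbols of length \<open>n + 1\<close>; the factor \<open>(y + n) / (x + n)\<close>,
  tending to 1, corrects for this.\<close>

lemma pochhammer_quotient_asymp:
  fixes x y :: real
  assumes "x > 0" "y > 0"
  shows "(\<lambda>n. pochhammer x n / pochhammer y n * real n powr (y - x)) \<longlonglongrightarrow> Gamma y / Gamma x"
proof -
  have "(\<lambda>n. Gamma_series y n / Gamma_series x n * ((y + real n) / (x + real n))) \<longlonglongrightarrow> Gamma y / Gamma x * 1"
  proof (intro tendsto_intros Gamma_series_LIMSEQ)
    show "Gamma x \<noteq> 0" using Gamma_real_pos[OF assms(1)] by simp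
    show "(\<lambda>n. (y + real n) / (x + real n)) \<longlonglongrightarrow> 1" by real_asymp
  qed
  moreover have "\<forall>\<^sub>F n in sequentially. Gamma_series y n / Gamma_series x n * ((y + real n) / (x + real n))
      = pochhammer x n / pochhammer y n * real n powr (y - x)"
    using eventually_gt_at_top[of 0]
  proof eventually_elim
    case (elim n)
    have "x + real n > 0" "y + real n > 0"
      using assms by auto
    moreover have "real n powr (y - x) = exp (y * ln n) / exp (x * ln n)"
      using elim by (simp add: powr_def left_diff_distrib exp_diff)
    ultimately show ?case
      by (simp add: Gamma_series_def pochhammer_Suc)
  qed
  ultimately show ?thesis
    by (simp add: Lim_transform_eventually)
qed

text \<open>Each upper parameter is paired with its well-poised partner, \<open>a\<close> with 1.
  The four exponents, less 1 for the growth of the linear factor, add up to the one stated.\<close>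

lemma dougall_term_asymp:
  assumes "a > 0" "b > 0" "c > 0" "d > 0" "b < 1 + a" "c < 1 + a" "d < 1 + a"
  shows "\<exists>L. (\<lambda>k. dougall_term a b c d k * real k powr (1 + 2 * (1 + a - b - c - d))) \<longlonglongrightarrow> L"
proof -
  define q where "q x y k = pochhammer x k / pochhammer y k * real k powr (y - x)" for x y :: real and k
  define L where "L = 2 / a * (Gamma 1 / Gamma a) * (Gamma (1 + a - b) / Gamma b) *
    (Gamma (1 + a - c) / Gamma c) * (Gamma (1 + a - d) / Gamma d)"
  have "(\<lambda>k. (1 + 2 * real k / a) / real k) \<longlonglongrightarrow> 2 / a"
    using assms(1) by (real_asymp simp: field_simps)
  then have "(\<lambda>k. (1 + 2 * real k / a) / real k * q a 1 k * q b (1 + a - b) k *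
      q c (1 + a - c) k * q d (1 + a - d) k) \<longlonglongrightarrow> L"
    unfolding L_def q_def using assms by (intro tendsto_mult pochhammer_quotient_asymp) auto
  moreover have "\<forall>\<^sub>F k in sequentially. (1 + 2 * real k / a) / real k * q a 1 k * q b (1 + a - b) k *
      q c (1 + a - c) k * q d (1 + a - d) k
    = dougall_term a b c d k * real k powr (1 + 2 * (1 + a - b - c - d))"
    using eventually_gt_at_top[of 0]
  proof eventually_elim
    case (elim k)
    have "real k powr (1 - a) * real k powr (1 + a - b - b) * real k powr (1 + a - c - c) *
        real k powr (1 + a - d - d) / real k
      = real k powr (1 - a) * real k powr (1 + a - b - b) * real k powr (1 + a - c - c) *
        real k powr (1 + a - d - d) * real k powr (-1)"
      using elim by (simp add: powr_minus divide_inverse)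
    also have "\<dots> = real k powr (1 + 2 * (1 + a - b - c - d))"
      unfolding powr_add[symmetric] by (simp add: algebra_simps)
    finally have *: "real k powr (1 + 2 * (1 + a - b - c - d)) =
        real k powr (1 - a) * real k powr (1 + a - b - b) * real k powr (1 + a - c - c) *
        real k powr (1 + a - d - d) / real k" by simp
    show ?case
      unfolding * q_def dougall_term_def pochhammer_fact by (simp add: mult_ac)
  qed
  ultimately have "(\<lambda>k. dougall_term a b c d k * real k powr (1 + 2 * (1 + a - b - c - d))) \<longlonglongrightarrow> L"
    by (rule Lim_transform_eventually)
  then show ?thesis ..
qed

context
  fixes a b c d :: real
  assumes pos: "a > 0" "b > 0" "c > 0" "d > 0" and excess: "b + c + d < 1 + a"
begin

lemma dougall_denominators_pos: "b < 1 + a" "c < 1 + a" "d < 1 + a"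
  using pos excess by auto

lemma summable_dougall_term: "summable (dougall_term a b c d)"
proof (rule summable_comparison_test_bigo)
  let ?s = "1 + 2 * (1 + a - b - c - d)"
  show "summable (\<lambda>k. norm (real k powr (- ?s)))"
    using excess by (simp add: summable_real_powr_iff)
  obtain L where L: "(\<lambda>k. dougall_term a b c d k * real k powr ?s) \<longlonglongrightarrow> L"
    using dougall_term_asymp[OF pos dougall_denominators_pos] by blast
  show "dougall_term a b c d \<in> O(\<lambda>k. real k powr (- ?s))"
  proof (rule bigoI_tendsto)
    show "(\<lambda>k. dougall_term a b c d k / real k powr (- ?s)) \<longlonglongrightarrow> L"
      using L by (simp only: powr_minus divide_inverse inverse_inverse_eq)
    show "\<forall>\<^sub>F k in sequentially. real k powr (- ?s) \<noteq> 0"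
      using eventually_gt_at_top[of 0] by eventually_elim simp
  qed
qed

text \<open>The certificate grows linearly while the terms are \<open>O(k powr -(1 + 2 * e))\<close>
  with excess \<open>e > 0\<close>.\<close>

lemma dougall_wz_boundary:
  "(\<lambda>k. - (k * (k + 1 + 2 * a - b - c - d) / (a + 2 * real k)) * dougall_term a b c d k) \<longlonglongrightarrow> 0"
proof -
  define e where "e = 1 + a - b - c - d"
  define h where "h = 1 + 2 * a - b - c - d"
  have "e > 0" using excess by (simp add: e_def)
  obtain L where L: "(\<lambda>k. dougall_term a b c d k * real k powr (1 + 2 * e)) \<longlonglongrightarrow> L"
    unfolding e_def using dougall_term_asymp[OF pos dougall_denominators_pos] by blast
  have "(\<lambda>k. - (real k * (real k + h) / (a + 2 * real k)) * real k powr - (1 + 2 * e)) \<longlonglongrightarrow> 0"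
    using \<open>e > 0\<close> by real_asymp
  from tendsto_mult[OF this L]
  have "(\<lambda>k. - (real k * (real k + h) / (a + 2 * real k)) * real k powr - (1 + 2 * e) *
      (dougall_term a b c d k * real k powr (1 + 2 * e))) \<longlonglongrightarrow> 0" by simp
  moreover have "\<forall>\<^sub>F k in sequentially. - (real k * (real k + h) / (a + 2 * real k)) * real k powr - (1 + 2 * e) *
      (dougall_term a b c d k * real k powr (1 + 2 * e))
    = - (k * (k + 1 + 2 * a - b - c - d) / (a + 2 * real k)) * dougall_term a b c d k"
    using eventually_gt_at_top[of 0]
  proof eventually_elim
    case (elim k)
    then have "real k powr - (1 + 2 * e) * real k powr (1 + 2 * e) = 1"
      by (simp flip: powr_add)
    then show ?case by (simp add: h_def add_ac add_diff_eq)
  qed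
  ultimately show ?thesis by (rule Lim_transform_eventually)
qed

end

section \<open>The shift relation for the sum and its limit\<close>

lemma dougall_suminf_shift:
  assumes pos: "a > 0" "b > 0" "c > 0" "d > 0" and excess: "b + c + d < 1 + a"
  shows "(\<Sum>k. dougall_term a b c d k) =
    (1 + a) * (1 + a - b - c) * (1 + a - b - d) * (1 + a - c - d) /
    ((1 + a - b) * (1 + a - c) * (1 + a - d) * (1 + a - b - c - d)) *
    (\<Sum>k. dougall_term (a + 1) b c d k)"
proof -
  define E where "E = 1 + a - b - c - d"
  define N where "N = (1 + a) * ((1 + a - b - c) * (1 + a - b - d) * (1 + a - c - d)) /
      ((1 + a - b) * (1 + a - c) * (1 + a - d))"
  note denom = dougall_denominators_pos[OF assms]
  have sums: "dougall_term a b c d sums suminf (dougall_term a b c d)"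
    "dougall_term (a + 1) b c d sums suminf (dougall_term (a + 1) b c d)"
    using assms by (auto intro!: summable_sums summable_dougall_term)
  \<comment> \<open>Summing the Wilf-Zeilberger identity telescopes: the boundary value vanishes at
    infinity, and at \<open>k = 0\<close> because of the factor \<open>k\<close>.\<close>
  have "(\<lambda>k. E * dougall_term a b c d k - N * dougall_term (a + 1) b c d k) sums 0"
    unfolding E_def N_def dougall_wz[OF pos(1) denom]
    using telescope_sums[OF dougall_wz_boundary[OF assms]] by simp
  moreover have "(\<lambda>k. E * dougall_term a b c d k - N * dougall_term (a + 1) b c d k) sums
      (E * suminf (dougall_term a b c d) - N * suminf (dougall_term (a + 1) b c d))"
    by (intro sums_diff sums_mult sums)
  ultimately have "E * suminf (dougall_term a b c d) = N * suminf (dougall_term (a + 1) b c d)"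
    using sums_unique2 by fastforce
  moreover have "E > 0" using excess by (simp add: E_def)
  ultimately have "suminf (dougall_term a b c d) = N / E * suminf (dougall_term (a + 1) b c d)"
    by (simp add: field_simps)
  then show ?thesis by (simp add: N_def E_def mult_ac)
qed

lemma dougall_suminf_shift_iterate:
  assumes "a > 0" "b > 0" "c > 0" "d > 0" "b + c + d < 1 + a"
  shows "(\<Sum>k. dougall_term a b c d k) =
    pochhammer (1 + a) n * pochhammer (1 + a - b - c) n * pochhammer (1 + a - b - d) n *
      pochhammer (1 + a - c - d) n /
    (pochhammer (1 + a - b) n * pochhammer (1 + a - c) n * pochhammer (1 + a - d) n *
      pochhammer (1 + a - b - c - d) n) *
    (\<Sum>k. dougall_term (a + n) b c d k)"
proof (induction n)
  case 0
  then show ?case by simp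
next
  case (Suc n)
  note Suc
  also have "(\<Sum>k. dougall_term (a + n) b c d k) = 
    (1 + a + n) * (1 + a - b - c + n) * (1 + a - b - d + n) * (1 + a - c - d + n) /
    ((1 + a - b + n) * (1 + a - c + n) * (1 + a - d + n) * (1 + a - b - c - d + n)) *
    (\<Sum>k. dougall_term (a + Suc n) b c d k)"
    using dougall_suminf_shift[of "a + n" b c d] assms by (simp add: algebra_simps)
  finally show ?case by (simp add: pochhammer_Suc mult_ac)
qed

text \<open>The ratio of consecutive terms has degree 2 over degree 4 in \<open>n\<close>, so every
  term but the first dies out.\<close>

lemma dougall_term_limit:
  assumes "a > 0"
  shows "(\<lambda>n. dougall_term (a + real n) b c d k) \<longlonglongrightarrow> (if k = 0 then 1 else 0)"
proof (induction k)
  case 0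
  then show ?case by simp
next
  case (Suc k)
  have "(\<lambda>n. (a + real n + 2 * real k + 2) * ((a + real n + k) * (b + k) * (c + k) * (d + k)) /
     ((a + real n + 2 * real k) * (k + 1) *
      ((1 + (a + real n) - b + k) * (1 + (a + real n) - c + k) * (1 + (a + real n) - d + k)))) \<longlonglongrightarrow> 0"
    by real_asymp
  from tendsto_mult[OF Suc this] show ?case
    using assms by (simp add: dougall_term_Suc)
qed

text \<open>Tannery's theorem applies: since terms decrease under \<open>a \<mapsto> a + 1\<close>,
  the series at \<open>n = 0\<close> dominates all the others.\<close>

lemma dougall_suminf_limit:
  assumes "a \<ge> 1/2" "b > 0" "c > 0" "d > 0" "b + c + d < 1 + a"
  shows "(\<lambda>n. \<Sum>k. dougall_term (a + real n) b c d k) \<longlonglongrightarrow> 1"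
proof -
  have bound: "norm (dougall_term (a + real n) b c d k) \<le> dougall_term a b c d k" for n k
  proof -
    have "dougall_term (a + real n) b c d k \<le> dougall_term a b c d k"
    proof (induction n)
      case (Suc n)
      have "dougall_term (a + real n + 1) b c d k \<le> dougall_term (a + real n) b c d k"
        using assms by (intro dougall_term_shift_le) auto
      with Suc show ?case by (simp add: add_ac)
    qed simp
    moreover have "dougall_term (a + real n) b c d k \<ge> 0"
      using assms by (intro dougall_term_nonneg) auto
    ultimately show ?thesis by simp
  qed
  have "(\<lambda>n. \<Sum>k. dougall_term (a + real n) b c d k) \<longlonglongrightarrow> (\<Sum>k. if k = 0 then 1 else 0 :: real)"
  proof (rule tannerys_theorem[where M = "dougall_term a b c d", THEN conjunct2, THEN conjunct2])
    show "(\<lambda>n. dougall_term (a + real n) b c d k) \<longlonglongrightarrow> (if k = 0 then 1 else 0)" for k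
      using assms by (intro dougall_term_limit) simp
    show "summable (dougall_term a b c d)"
      using assms by (intro summable_dougall_term) auto
  qed (simp_all add: bound[simplified] case_prod_unfold)
  also have "(\<Sum>k. if k = 0 then 1 else 0 :: real) = 1"
    using suminf_finite[of "{0::nat}" "\<lambda>k. if k = 0 then 1 else 0 :: real"] by simp
  finally show ?thesis .
qed

theorem dougall_5F4:
  assumes "a \<ge> 1/2" "b > 0" "c > 0" "d > 0" "b + c + d < 1 + a"
  shows "dougall_term a b c d sums
    (Gamma (1 + a - b) * Gamma (1 + a - c) * Gamma (1 + a - d) * Gamma (1 + a - b - c - d) /
     (Gamma (1 + a) * Gamma (1 + a - b - c) * Gamma (1 + a - b - d) * Gamma (1 + a - c - d)))"
    (is "_ sums ?W")
proof -
  define S where "S = suminf (dougall_term a b c d)"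
  define q where "q x y n = pochhammer x n / pochhammer y n * real n powr (y - x)" for x y :: real and n
  \<comment> \<open>The Pochhammer symbols are paired so that the exponents of \<open>n\<close> are
    \<open>-b, b, b, -b\<close>; the powers cancel and the product is the constant
    \<open>S\<close>.\<close>
  have "(\<lambda>n. q (1 + a) (1 + a - b) n * q (1 + a - b - c) (1 + a - c) n *
      q (1 + a - b - d) (1 + a - d) n * q (1 + a - c - d) (1 + a - b - c - d) n *
      (\<Sum>k. dougall_term (a + real n) b c d k))
    \<longlonglongrightarrow> (Gamma (1 + a - b) / Gamma (1 + a)) * (Gamma (1 + a - c) / Gamma (1 + a - b - c)) *
      (Gamma (1 + a - d) / Gamma (1 + a - b - d)) *
      (Gamma (1 + a - b - c - d) / Gamma (1 + a - c - d)) * 1"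
    unfolding q_def using assms
    by (intro tendsto_mult dougall_suminf_limit pochhammer_quotient_asymp) auto
  moreover have "\<forall>\<^sub>F n in sequentially. q (1 + a) (1 + a - b) n * q (1 + a - b - c) (1 + a - c) n *
      q (1 + a - b - d) (1 + a - d) n * q (1 + a - c - d) (1 + a - b - c - d) n *
      (\<Sum>k. dougall_term (a + real n) b c d k) = S"
    using eventually_gt_at_top[of 0]
  proof eventually_elim
    case (elim n)
    have "real n powr (1 + a - b - (1 + a)) * real n powr (1 + a - c - (1 + a - b - c)) *
        (real n powr (1 + a - d - (1 + a - b - d)) *
        real n powr (1 + a - b - c - d - (1 + a - c - d))) = 1"
      using elim by (simp flip: powr_add)
    moreover have "p1 / p2 * x1 * (p3 / p4 * x2) * (p5 / p6 * x3) * (p7 / p8 * x4) =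
        p1 * p3 * p5 * p7 / (p2 * p4 * p6 * p8) * (x1 * x2 * (x3 * x4))"
      for p1 p2 p3 p4 p5 p6 p7 p8 x1 x2 x3 x4 :: real
      by simp
    ultimately have "q (1 + a) (1 + a - b) n * q (1 + a - b - c) (1 + a - c) n *
      q (1 + a - b - d) (1 + a - d) n * q (1 + a - c - d) (1 + a - b - c - d) n =
      pochhammer (1 + a) n * pochhammer (1 + a - b - c) n * pochhammer (1 + a - b - d) n *
      pochhammer (1 + a - c - d) n /
      (pochhammer (1 + a - b) n * pochhammer (1 + a - c) n * pochhammer (1 + a - d) n *
      pochhammer (1 + a - b - c - d) n)"
      unfolding q_def by simp
    then show ?case
      unfolding S_def using dougall_suminf_shift_iterate[of a b c d n] assms by simp
  qed
  ultimately have "(\<lambda>_. S) \<longlonglongrightarrow> (Gamma (1 + a - b) / Gamma (1 + a)) * (Gamma (1 + a - c) / Gamma (1 + a - b - c)) *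
      (Gamma (1 + a - d) / Gamma (1 + a - b - d)) *
      (Gamma (1 + a - b - c - d) / Gamma (1 + a - c - d)) * 1"
    by (rule Lim_transform_eventually)
  then have "S = ?W"
    by (simp add: tendsto_const_iff mult_ac)
  then show ?thesis
    unfolding S_def using summable_dougall_term[of a b c d] assms by (auto simp: sums_iff)
qed

section \<open>The hypergeometric value at 1\<close>

lemma pochhammer_Suc_quotient:
  fixes x :: real
  assumes "x > 0"
  shows "pochhammer x k / pochhammer (x + 1) k = x / (x + k)"
  using assms pochhammer_pos[OF assms, of k] by (simp add: pochhammer_shift add_pos_nonneg)

text \<open>The cases \<open>d = 1/4\<close> (an instance of Dixon's theorem) and \<open>d = 3/4\<close> of Dougall's theorem.\<close>
lemma hypergeom_half_half_sums:
  fixes c :: real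
  assumes "0 < c" "c < 1/4"
  defines "t \<equiv> \<lambda>k. (pochhammer (1/2) k)\<^sup>2 * pochhammer c k / ((fact k)\<^sup>2 * pochhammer (3/2 - c) k)"
  shows "t sums (Gamma (3/2 - c) * Gamma (5/4) * Gamma (3/4 - c) /
      (Gamma (3/2) * Gamma (1 - c) * Gamma (3/4) * Gamma (5/4 - c)))" (is "_ sums ?A")
    and "(\<lambda>k. (1 + 4 * real k) * t k) sums (Gamma (3/2 - c) * Gamma (3/4) * Gamma (1/4 - c) /
      (Gamma (3/2) * Gamma (1 - c) * Gamma (1/4) * Gamma (3/4 - c)))" (is "_ sums ?B")
proof -
  \<comment> \<open>Here \<open>1 + a - d = d + 1\<close>, so the \<open>d\<close>-quotient is
    \<open>1 / (1 + 4 * k)\<close> and cancels the linear factor.\<close>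
  have "dougall_term (1/2) (1/2) c (1/4) k = t k" for k
  proof -
    have "dougall_term (1/2) (1/2) c (1/4) k =
        (1 + 4 * real k) * t k * (pochhammer (1/4) k / pochhammer (1/4 + 1) k)"
      by (simp add: dougall_term_def t_def pochhammer_fact power2_eq_square)
    also have "\<dots> = t k"
      by (subst pochhammer_Suc_quotient) (auto simp: field_simps)
    finally show ?thesis .
  qed
  then have "t = dougall_term (1/2) (1/2) c (1/4)" by auto
  with dougall_5F4[of "1/2" "1/2" c "1/4"] assms(1,2) show "t sums ?A"
    by (simp add: mult_ac)
  \<comment> \<open>Now \<open>1 + a - d = d\<close>, so the \<open>d\<close>-quotient is 1 and the
    linear factor survives. Positive excess here means exactly \<open>c < 1/4\<close>.\<close>
  have "dougall_term (1/2) (1/2) c (3/4) k = (1 + 4 * real k) * t k" for k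
    using pochhammer_pos[of "3/4 :: real" k]
    by (simp add: dougall_term_def t_def pochhammer_fact power2_eq_square)
  then have "(\<lambda>k. (1 + 4 * real k) * t k) = dougall_term (1/2) (1/2) c (3/4)" by auto
  with dougall_5F4[of "1/2" "1/2" c "3/4"] assms(1,2) show "(\<lambda>k. (1 + 4 * real k) * t k) sums ?B"
    by (simp add: mult_ac)
qed

lemma Gamma_plus1_real:
  fixes x :: real
  assumes "x > 0"
  shows "Gamma (x + 1) = x * Gamma x"
  using assms by (intro Gamma_plus1) (auto elim!: nonpos_Ints_cases')

lemma hypergeom_3F2_eq:
  fixes c :: real
  assumes "0 < c" "c < 1/4"
  shows "hypergeom_3F2 (1/2) (1/2) c 1 (1/2 - c) 1 =
    Gamma (1/2 - c) / (Gamma (3/2) * Gamma (1 - c)) *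
    (Gamma (3/4) * Gamma (1/4 - c) / (4 * Gamma (1/4) * Gamma (3/4 - c)) +
     (1/4 - c) * Gamma (5/4) * Gamma (3/4 - c) / (Gamma (3/4) * Gamma (5/4 - c)))"
proof -
  define t where "t = (\<lambda>k. (pochhammer (1/2) k)\<^sup>2 * pochhammer c k / ((fact k)\<^sup>2 * pochhammer (3/2 - c) k))"
  define A where "A = Gamma (3/2 - c) * Gamma (5/4) * Gamma (3/4 - c) /
      (Gamma (3/2) * Gamma (1 - c) * Gamma (3/4) * Gamma (5/4 - c))"
  define B where "B = Gamma (3/2 - c) * Gamma (3/4) * Gamma (1/4 - c) /
      (Gamma (3/2) * Gamma (1 - c) * Gamma (1/4) * Gamma (3/4 - c))"
  have sums: "t sums A" "(\<lambda>k. (1 + 4 * real k) * t k) sums B"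
    unfolding t_def A_def B_def using assms by (rule hypergeom_half_half_sums)+
  have "pochhammer (1/2) k * pochhammer (1/2) k * pochhammer c k /
      (fact k * pochhammer 1 k * pochhammer (1/2 - c) k) * 1 ^ k =
      1 / (1/2 - c) * (1/4 * ((1 + 4 * real k) * t k) + (1/4 - c) * t k)" for k
  proof -
    have "pochhammer (3/2 - c) k = pochhammer (1/2 - c) k * ((1/2 - c + k) / (1/2 - c))"
      using pochhammer_shift[of "1/2 - c" k] assms by simp
    moreover have "1/2 - c + real k > 0" "pochhammer (1/2 - c) k > 0"
      using assms by (auto intro: pochhammer_pos)
    ultimately have "pochhammer (1/2) k * pochhammer (1/2) k * pochhammer c k /
      (fact k * pochhammer 1 k * pochhammer (1/2 - c) k) = t k * ((1/2 - c + k) / (1/2 - c))"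
      using assms by (simp add: t_def pochhammer_fact power2_eq_square)
    also have "1/2 - c + k = 1/4 * (1 + 4 * real k) + (1/4 - c)" by (simp add: field_simps)
    finally show ?thesis by (simp add: algebra_simps add_divide_distrib diff_divide_distrib)
  qed
  moreover have "(\<lambda>k. 1 / (1/2 - c) * (1/4 * ((1 + 4 * real k) * t k) + (1/4 - c) * t k)) sums
      (1 / (1/2 - c) * (1/4 * B + (1/4 - c) * A))"
    by (intro sums_mult sums_add sums)
  ultimately have "hypergeom_3F2 (1/2) (1/2) c 1 (1/2 - c) 1 = 1 / (1/2 - c) * (1/4 * B + (1/4 - c) * A)"
    unfolding hypergeom_3F2_def by (simp add: sums_iff)
  moreover have "Gamma (3/2 - c) = (1/2 - c) * Gamma (1/2 - c)"
    using Gamma_plus1_real[of "1/2 - c"] assms by simp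
  \<comment> \<open>Field arithmetic with the Gamma values generalised to variables:
    \<open>p\<close> is \<open>1/2 - c\<close> and \<open>g\<close> is
    \<open>Gamma (1/2 - c)\<close>.\<close>
  moreover have "1 / p * (1/4 * (p * g * x1 * x2 / (y1 * y2 * y3 * y4)) + q * (p * g * x3 * x4 / (y1 * y2 * y5 * y6))) =
      g / (y1 * y2) * (x1 * x2 / (4 * y3 * y4) + q * x3 * x4 / (y5 * y6))" if "p > 0"
    for p q g x1 x2 x3 x4 y1 y2 y3 y4 y5 y6 :: real
    using that by (simp add: distrib_left mult_ac)
  ultimately show ?thesis
    using assms by (simp only: A_def B_def)
qed

section \<open>Reflection, duplication and squares of Beta values\<close>

text \<open>Transferred from the complex formula. At integers both sides are 0: one Gamma factor
  sits at a pole, where its value is 0, and the right side divides by zero.\<close>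

lemma Gamma_reflection_real:
  fixes x :: real
  shows "Gamma x * Gamma (1 - x) = pi / sin (pi * x)"
proof -
  let ?z = "complex_of_real x"
  have "complex_of_real (Gamma x * Gamma (1 - x)) = Gamma ?z * Gamma (1 - ?z)"
    using Gamma_complex_of_real[of x] Gamma_complex_of_real[of "1 - x"] by simp
  also have "\<dots> = of_real pi / sin (of_real pi * ?z)"
    by (rule Gamma_reflection_complex)
  also have "sin (of_real pi * ?z) = complex_of_real (sin (pi * x))"
    using sin_of_real[of "pi * x", where 'a = complex] by simp
  finally have "complex_of_real (Gamma x * Gamma (1 - x)) = complex_of_real (pi / sin (pi * x))"
    by simp
  then show ?thesis by (simp only: of_real_eq_iff)
qed

lemma Gamma_legendre_duplication_real:
  fixes x :: real
  assumes "x > 0"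
  shows "Gamma x * Gamma (x + 1/2) = 2 powr (1 - 2 * x) * sqrt pi * Gamma (2 * x)"
proof -
  let ?z = "complex_of_real x"
  have "complex_of_real (Gamma x * Gamma (x + 1/2)) = Gamma ?z * Gamma (?z + 1/2)"
    using Gamma_complex_of_real[of x] Gamma_complex_of_real[of "x + 1/2"] by simp
  also have "\<dots> = exp ((1 - 2 * ?z) * of_real (ln 2)) * of_real (sqrt pi) * Gamma (2 * ?z)"
  proof (rule Gamma_legendre_duplication)
    show "?z \<notin> \<int>\<^sub>\<le>\<^sub>0" "?z + 1/2 \<notin> \<int>\<^sub>\<le>\<^sub>0"
      using assms by (auto elim!: nonpos_Ints_cases' simp: complex_eq_iff)
  qed
  also have "exp ((1 - 2 * ?z) * of_real (ln 2)) = complex_of_real (2 powr (1 - 2 * x))"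
    by (simp add: powr_def exp_of_real[symmetric])
  also have "Gamma (2 * ?z) = complex_of_real (Gamma (2 * x))"
    using Gamma_complex_of_real[of "2 * x"] by simp
  finally have "complex_of_real (Gamma x * Gamma (x + 1/2)) =
      complex_of_real (2 powr (1 - 2 * x) * sqrt pi * Gamma (2 * x))"
    by simp
  then show ?thesis by (simp only: of_real_eq_iff)
qed

text \<open>Reflecting the Gamma values at \<open>1 - c\<close>, \<open>1 - s\<close> and
  \<open>1 - s - c\<close> cancels all powers of \<open>pi\<close> and leaves the square of the Beta
  quotient.\<close>

lemma Gamma_quotient_eq_Beta_square:
  fixes s c :: real
  assumes "0 < s" "s < 1" "0 < c" "s + c < 1"
  shows "Gamma c * Gamma s * (Gamma (1 - s - c))\<^sup>2 / (Gamma (1 - c) * Gamma (1 - s)) =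
    sin (pi * c) * sin (pi * s) / (sin (pi * (s + c)))\<^sup>2 * (Beta s c)\<^sup>2"
proof -
  have sin: "sin (pi * x) > 0" if "0 < x" "x < 1" for x
    using that by (intro sin_gt_zero) auto
  have refl: "Gamma (1 - x) = pi / (sin (pi * x) * Gamma x)" if "0 < x" for x :: real
  proof -
    have "Gamma (1 - x) = Gamma x * Gamma (1 - x) / Gamma x"
      using Gamma_real_pos[OF that] by simp
    then show ?thesis by (simp add: Gamma_reflection_real)
  qed
  have "Gamma c > 0" "Gamma s > 0" "Gamma (s + c) > 0"
    using assms by (auto intro: Gamma_real_pos)
  moreover have "Gamma (1 - s - c) = pi / (sin (pi * (s + c)) * Gamma (s + c))"
    using refl[of "s + c"] assms by (simp add: diff_diff_eq)
  ultimately show ?thesis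
    using sin[of c] sin[of s] sin[of "s + c"] assms
    by (simp add: refl Beta_def power2_eq_square mult_ac)
qed

lemma pi_Beta_hypergeom_3F2_eq:
  fixes c :: real
  assumes "0 < c" "c < 1/4"
  shows "pi * Beta c (1/2 - 2 * c) * hypergeom_3F2 (1/2) (1/2) c 1 (1/2 - c) 1 =
    2 powr (- 3/2 - 2 * c) * sin (pi * c) * sin (pi * (1/4)) / (sin (pi * (1/4 + c)))\<^sup>2 * (Beta (1/4) c)\<^sup>2 +
    2 powr (- 3/2 - 2 * c) * sin (pi * c) * sin (pi * (3/4)) / (sin (pi * (3/4 + c)))\<^sup>2 * (Beta (3/4) c)\<^sup>2"
proof -
  define g1 where "g1 = Gamma (1/4 - c)"
  define g3 where "g3 = Gamma (3/4 - c)"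
  define r where "r = (2::real) powr (- 3/2 - 2 * c)"
  have pos: "g1 > 0" "g3 > 0" "Gamma c > 0" "Gamma (1 - c) > 0" "Gamma (1/2 - c) > 0"
    "Gamma (1/4 :: real) > 0" "Gamma (3/4 :: real) > 0"
    unfolding g1_def g3_def using assms by (auto intro!: Gamma_real_pos)
  \<comment> \<open>Duplication at \<open>1/4 - c\<close>. The product \<open>g1 * g3\<close> meets
    the quotients \<open>g1 / g3\<close> and \<open>g3 / g1\<close> of the two series values and
    turns them into the squares of \<open>g1\<close> and \<open>g3\<close>.\<close>
  have "g1 * g3 = 2 powr (1/2 + 2 * c) * sqrt pi * Gamma (1/2 - 2 * c)"
    using Gamma_legendre_duplication_real[of "1/4 - c"] assms by (simp add: g1_def g3_def algebra_simps)
  moreover have "r * 2 powr (1/2 + 2 * c) = 1/2"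
    unfolding r_def powr_add[symmetric] by (simp add: powr_minus)
  ultimately have dup: "sqrt pi * Gamma (1/2 - 2 * c) = 2 * r * (g1 * g3)"
    by simp
  have Gamma_consts: "Gamma (5/4 :: real) = Gamma (1/4) / 4" "Gamma (3/2 :: real) = sqrt pi / 2"
    using Gamma_plus1_real[of "1/4"] Gamma_plus1_real[of "1/2"] Gamma_one_half_real
    by simp_all
  have Gamma_54: "Gamma (5/4 - c) = (1/4 - c) * g1"
    using Gamma_plus1_real[of "1/4 - c"] assms by (simp add: g1_def)
  have "pi * Beta c (1/2 - 2 * c) * hypergeom_3F2 (1/2) (1/2) c 1 (1/2 - c) 1 =
      pi * (Gamma c * Gamma (1/2 - 2 * c) / Gamma (1/2 - c)) *
      (Gamma (1/2 - c) / (sqrt pi / 2 * Gamma (1 - c)) *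
        (Gamma (3/4) * g1 / (4 * Gamma (1/4) * g3) +
        (1/4 - c) * (Gamma (1/4) / 4) * g3 / (Gamma (3/4) * ((1/4 - c) * g1))))"
    unfolding hypergeom_3F2_eq[OF assms] Gamma_consts Gamma_54 Beta_def by (simp add: g1_def g3_def)
  also have "\<dots> = (pi / sqrt pi * Gamma (1/2 - 2 * c)) * (2 * Gamma c / Gamma (1 - c)) *
        (Gamma (3/4) * g1 / (4 * Gamma (1/4) * g3) + Gamma (1/4) * g3 / (4 * Gamma (3/4) * g1))"
  proof -
    have "x * (y * w / v) * (v / (z / 2 * u) * (p + q * (s / 4) * k / (h * (q * l)))) =
        (x / z * w) * (2 * y / u) * (p + s * k / (4 * h * l))" if "v > 0" "q > 0"
      for x y z w v u p q s k h l :: real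
      using that by simp
    then show ?thesis by this (use pos assms in auto)
  qed
  also have "pi / sqrt pi * Gamma (1/2 - 2 * c) = 2 * r * (g1 * g3)"
    unfolding dup[symmetric] by (simp add: real_div_sqrt)
  also have "2 * r * (g1 * g3) * (2 * Gamma c / Gamma (1 - c)) *
        (Gamma (3/4) * g1 / (4 * Gamma (1/4) * g3) + Gamma (1/4) * g3 / (4 * Gamma (3/4) * g1)) =
      r * (Gamma c * Gamma (1/4) * g3\<^sup>2 / (Gamma (1 - c) * Gamma (3/4))) +
      r * (Gamma c * Gamma (3/4) * g1\<^sup>2 / (Gamma (1 - c) * Gamma (1/4)))"
  proof -
    have "2 * r * (g1 * g3) * (2 * x / y) * (z * g1 / (4 * w * g3) + w * g3 / (4 * z * g1)) =
        r * (x * w * g3\<^sup>2 / (y * z)) + r * (x * z * g1\<^sup>2 / (y * w))" for x y z w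
      using pos(1,2) by (simp add: distrib_left power2_eq_square mult_ac)
    then show ?thesis .
  qed
  \<comment> \<open>The pairing is crossed: \<open>s = 1/4\<close> gives
    \<open>1 - s - c = 3/4 - c\<close>, so \<open>g3\<close> belongs to \<open>Beta (1/4) c\<close>
    and \<open>g1\<close> to \<open>Beta (3/4) c\<close>.\<close>
  also have "Gamma c * Gamma (1/4) * g3\<^sup>2 / (Gamma (1 - c) * Gamma (3/4)) =
      sin (pi * c) * sin (pi * (1/4)) / (sin (pi * (1/4 + c)))\<^sup>2 * (Beta (1/4) c)\<^sup>2"
    using Gamma_quotient_eq_Beta_square[of "1/4" c] assms by (simp add: g3_def)
  also have "Gamma c * Gamma (3/4) * g1\<^sup>2 / (Gamma (1 - c) * Gamma (1/4)) =
      sin (pi * c) * sin (pi * (3/4)) / (sin (pi * (3/4 + c)))\<^sup>2 * (Beta (3/4) c)\<^sup>2"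
    using Gamma_quotient_eq_Beta_square[of "3/4" c] assms by (simp add: g1_def)
  finally show ?thesis
    by (simp add: r_def mult.assoc)
qed

theorem theorem1p1:
  fixes m :: nat
  assumes "m > 4"
  shows "\<exists>\<alpha>1 \<alpha>2 :: complex. algebraic \<alpha>1 \<and> algebraic \<alpha>2 \<and>
    complex_of_real (pi * Beta (1 / real m) (1/2 - 2 / real m) *
        hypergeom_3F2 (1/2) (1/2) (1 / real m) 1 (1/2 - 1 / real m) 1) =
      \<alpha>1 * complex_of_real ((Beta (1/4) (1 / real m))\<^sup>2) +
      \<alpha>2 * complex_of_real ((Beta (3/4) (1 / real m))\<^sup>2)"
proof -
  define c where "c = 1 / real m"
  have c: "0 < c" "c < 1/4" using assms by (auto simp: c_def field_simps)
  have "c \<in> \<rat>" by (simp add: c_def)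
  \<comment> \<open>One formula yields both coefficients, at \<open>s = 1/4\<close> and
    \<open>s = 3/4\<close>; it combines a rational power of 2 with sines of rational multiples of
    \<open>pi\<close>.\<close>
  define \<alpha> where "\<alpha> s = 2 powr (- 3/2 - 2 * c) * sin (pi * c) * sin (pi * s) / (sin (pi * (s + c)))\<^sup>2" for s
  have alg: "algebraic (complex_of_real (\<alpha> s))" if "s \<in> \<rat>" for s
    unfolding \<alpha>_def of_real_mult of_real_divide of_real_power using that \<open>c \<in> \<rat>\<close>
    by (intro algebraic_mult algebraic_divide algebraic_power algebraic_sin_rational_pi algebraic_powr_rational) auto
  have "complex_of_real (pi * Beta c (1/2 - 2 * c) * hypergeom_3F2 (1/2) (1/2) c 1 (1/2 - c) 1) =
      complex_of_real (\<alpha> (1/4)) * complex_of_real ((Beta (1/4) c)\<^sup>2) +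
      complex_of_real (\<alpha> (3/4)) * complex_of_real ((Beta (3/4) c)\<^sup>2)"
    unfolding pi_Beta_hypergeom_3F2_eq[OF c] \<alpha>_def by (simp only: of_real_add of_real_mult)
  then have "complex_of_real (pi * Beta (1 / real m) (1/2 - 2 / real m) *
        hypergeom_3F2 (1/2) (1/2) (1 / real m) 1 (1/2 - 1 / real m) 1) =
      complex_of_real (\<alpha> (1/4)) * complex_of_real ((Beta (1/4) (1 / real m))\<^sup>2) +
      complex_of_real (\<alpha> (3/4)) * complex_of_real ((Beta (3/4) (1 / real m))\<^sup>2)"
    by (simp only: c_def times_divide_eq_right mult_1_right)
  moreover have "algebraic (complex_of_real (\<alpha> (1/4)))" "algebraic (complex_of_real (\<alpha> (3/4)))"
    by (rule alg, simp)+
  ultimately show ?thesis by blast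
qed

end
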